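(* Let $n$ and $q$ be natural numbers. There exists a natural number $m_0=m_0(n,q)$ such that for all natural numbers $p$ and $m$ with $p\leqslant 2q-1$ and $m\geqslant m_0$, Breaker has a winning strategy for the $(p,q)$-crossing game on $\Lambda_{m\times n}$.
   Context: $\Lambda_{m\times n}$ is the grid graph with vertex set $\{(x,y): x\in[m], y\in[n]\}$, two vertices adjacent iff at Euclidean distance $1$. A left-right crossing path is a path in the board joining some vertex $(1,y)$ to some vertex $(m,y')$. The $(p,q)$-crossing game on $\Lambda_{m\times n}$: Maker and Breaker alternate turns, Maker first. On each turn Maker claims $p$ as-yet unclaimed edges and Breaker claims $q$ as-yet unclaimed edges. Maker wins if she claims all edges of a left-right crossing path; Breaker wins if the board reaches a state where Maker can never claim such a path. *)

theory Defs
  imports "HOL-Analysis.Product_Vector"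
begin

type_synonym vertex = "nat \<times> nat"
type_synonym edge = "vertex set"

definition grid_vertices :: "nat \<Rightarrow> nat \<Rightarrow> vertex set" where
  "grid_vertices m n = {1..m} \<times> {1..n}"

text \<open>The metric on \<open>real \<times> real\<close> is the Euclidean one.\<close>

definition grid_adjacent :: "vertex \<Rightarrow> vertex \<Rightarrow> bool" where
  "grid_adjacent u v \<longleftrightarrow>
     dist (real (fst u), real (snd u)) (real (fst v), real (snd v)) = 1"

definition grid_edges :: "nat \<Rightarrow> nat \<Rightarrow> edge set" where
  "grid_edges m n =
     {{u, v} | u v. u \<in> grid_vertices m n \<and> v \<in> grid_vertices m n \<and> grid_adjacent u v}"

definition grid_path :: "nat \<Rightarrow> nat \<Rightarrow> vertex list \<Rightarrow> bool" where
  "grid_path m n P \<longleftrightarrow> P \<noteq> [] \<and> distinct P \<and> set P \<subseteq> grid_vertices m n \<and>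
     successively (\<lambda>u v. {u, v} \<in> grid_edges m n) P"

definition path_edges :: "vertex list \<Rightarrow> edge set" where
  "path_edges P = {{P ! i, P ! Suc i} | i. Suc i < length P}"

definition left_right_crossing_path :: "nat \<Rightarrow> nat \<Rightarrow> vertex list \<Rightarrow> bool" where
  "left_right_crossing_path m n P \<longleftrightarrow>
     grid_path m n P \<and> fst (hd P) = 1 \<and> fst (last P) = m"

text \<open>A history is the list of the sets of edges claimed on the turns played so far.
  Turns are numbered from 0, so Maker claims on the even turns and Breaker on the odd ones.\<close>

type_synonym history = "edge set list"

definition maker_claimed :: "history \<Rightarrow> edge set" where
  "maker_claimed h = \<Union> {h ! i | i. i < length h \<and> even i}"

definition unclaimed :: "nat \<Rightarrow> nat \<Rightarrow> history \<Rightarrow> edge set" where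
  "unclaimed m n h = grid_edges m n - \<Union> (set h)"

text \<open>A player who faces fewer unclaimed edges than she is due to claim takes all of them.
  In particular there is always a legal move, and all moves are empty once the board is full.\<close>

definition legal_move :: "nat \<Rightarrow> nat \<Rightarrow> nat \<Rightarrow> nat \<Rightarrow> history \<Rightarrow> edge set \<Rightarrow> bool" where
  "legal_move p q m n h C \<longleftrightarrow> C \<subseteq> unclaimed m n h \<and>
     card C = min (if even (length h) then p else q) (card (unclaimed m n h))"

definition legal_history :: "nat \<Rightarrow> nat \<Rightarrow> nat \<Rightarrow> nat \<Rightarrow> history \<Rightarrow> bool" where
  "legal_history p q m n h \<longleftrightarrow> (\<forall>i<length h. legal_move p q m n (take i h) (h ! i))"

definition maker_has_crossing :: "nat \<Rightarrow> nat \<Rightarrow> history \<Rightarrow> bool" where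
  "maker_has_crossing m n h \<longleftrightarrow>
     (\<exists>P. left_right_crossing_path m n P \<and> path_edges P \<subseteq> maker_claimed h)"

text \<open>Maker can never claim a crossing path, however both players continue from \<open>h\<close>.
  With an empty continuation this includes that she has not claimed one yet.\<close>

definition breaker_has_won :: "nat \<Rightarrow> nat \<Rightarrow> nat \<Rightarrow> nat \<Rightarrow> history \<Rightarrow> bool" where
  "breaker_has_won p q m n h \<longleftrightarrow>
     (\<forall>h'. legal_history p q m n (h @ h') \<longrightarrow> \<not> maker_has_crossing m n (h @ h'))"

text \<open>Plays are continued forever, also after the game has been decided; this does not affect
  who wins, since \<open>maker_has_crossing\<close> and \<open>breaker_has_won\<close> persist along a play and
  exclude each other.\<close>

definition legal_play :: "nat \<Rightarrow> nat \<Rightarrow> nat \<Rightarrow> nat \<Rightarrow> (nat \<Rightarrow> edge set) \<Rightarrow> bool" where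
  "legal_play p q m n f \<longleftrightarrow> (\<forall>t. legal_move p q m n (map f [0..<t]) (f t))"

text \<open>A strategy has to answer every legal history with a legal move, so that Breaker cannot win
  vacuously by refusing to move.\<close>

definition breaker_strategy :: "nat \<Rightarrow> nat \<Rightarrow> nat \<Rightarrow> nat \<Rightarrow> (history \<Rightarrow> edge set) \<Rightarrow> bool" where
  "breaker_strategy p q m n \<sigma> \<longleftrightarrow>
     (\<forall>h. legal_history p q m n h \<and> odd (length h) \<longrightarrow> legal_move p q m n h (\<sigma> h))"

definition breaker_follows :: "(history \<Rightarrow> edge set) \<Rightarrow> (nat \<Rightarrow> edge set) \<Rightarrow> bool" where
  "breaker_follows \<sigma> f \<longleftrightarrow> (\<forall>t. odd t \<longrightarrow> f t = \<sigma> (map f [0..<t]))"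

definition breaker_has_winning_strategy :: "nat \<Rightarrow> nat \<Rightarrow> nat \<Rightarrow> nat \<Rightarrow> bool" where
  "breaker_has_winning_strategy p q m n \<longleftrightarrow>
     (\<exists>\<sigma>. breaker_strategy p q m n \<sigma> \<and>
        (\<forall>f. legal_play p q m n f \<and> breaker_follows \<sigma> f \<longrightarrow>
           (\<exists>t. breaker_has_won p q m n (map f [0..<t]))))"

end

theory Submission imports Defs "HOL-Library.Disjoint_Sets" begin

text \<open>Cut the board into many disjoint zones of \<open>n + 2\<close> consecutive columns. In a zone, let each
  of the \<open>n\<^sup>2\<close> vertices in the inner columns own two of its edges, so that every edge meeting an inner
  column is owned by exactly one of its ends. A crossing path passes through some number \<open>k\<close> of
  consecutive inner vertices using \<open>k + 1\<close> edges, so by pigeonhole it uses both edges of some owner.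
  Hence Breaker wins once he has an edge of every pair of a single zone.

  Call a zone alive if Maker has at most one edge in the pairs not yet hit by Breaker. Touching an
  alive zone, Breaker hits one more pair and removes the threat, so that Maker then needs two edges to
  kill the zone. With \<open>c = 2q\<close>, let an alive zone with \<open>l\<close> pairs hit weigh \<open>2c\<^sup>l\<close>, or \<open>c\<^sup>l\<close> if it contains a
  threat. Breaker touches \<open>q\<close> alive zones of the least level \<open>l\<close> at which there are that many; no
  alive zone then has level above \<open>l + 1\<close>. A round gains at least \<open>2q(c\<^sup>l\<^sup>+\<^sup>1 - c\<^sup>l)\<close> and loses at most
  \<open>(2q - 1)c\<^sup>l\<^sup>+\<^sup>1\<close>, so the total weight never decreases. It remains too large for fewer than \<open>q\<close>
  alive zones at every level, so Breaker can continue until he completes a zone.\<close>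

section \<open>A game on zones of disjoint pairs, and its potential\<close>

lemma sum_card_Int_le:
  assumes "finite Z" "finite D" "disjoint_family_on S Z"
  shows "(\<Sum>z\<in>Z. card (D \<inter> S z)) \<le> card D"
proof -
  have "(\<Sum>z\<in>Z. card (D \<inter> S z)) = card (\<Union>z\<in>Z. D \<inter> S z)"
    using assms by (intro card_UN_disjoint[symmetric]) (auto simp: disjoint_family_on_def)
  also have "\<dots> \<le> card D"
    using assms(2) by (intro card_mono) auto
  finally show ?thesis .
qed

text \<open>The board enters the potential argument only as a set \<open>Z\<close> of zones with
  pairs \<open>pr z i\<close> indexed by owners \<open>i\<close>. By \<open>pr_unique\<close> an
  element lies in at most one pair of one zone, so a single claim affects a single zone.\<close>

locale pair_boxes =
  fixes Z :: "'z set" and I :: "'i set" and pr :: "'z \<Rightarrow> 'i \<Rightarrow> 'e set"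
  assumes fin_Z: "finite Z" and fin_I: "finite I"
    and card_pr: "\<And>z i. z \<in> Z \<Longrightarrow> i \<in> I \<Longrightarrow> card (pr z i) = 2"
    and pr_unique: "\<And>z i z' i' e. z \<in> Z \<Longrightarrow> i \<in> I \<Longrightarrow> z' \<in> Z \<Longrightarrow> i' \<in> I \<Longrightarrow>
      e \<in> pr z i \<Longrightarrow> e \<in> pr z' i' \<Longrightarrow> z = z' \<and> i = i'"
begin

definition hit :: "'e set \<Rightarrow> 'z \<Rightarrow> 'i set" where
  "hit B z = {i \<in> I. pr z i \<inter> B \<noteq> {}}"

definition threats :: "'e set \<Rightarrow> 'e set \<Rightarrow> 'z \<Rightarrow> 'e set" where
  "threats M B z = M \<inter> (\<Union>i\<in>I - hit B z. pr z i)"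

definition alive :: "'e set \<Rightarrow> 'e set \<Rightarrow> 'z set" where
  "alive M B = {z \<in> Z. card (threats M B z) \<le> 1}"

definition alive_at :: "'e set \<Rightarrow> 'e set \<Rightarrow> nat \<Rightarrow> 'z set" where
  "alive_at M B l = {z \<in> alive M B. card (hit B z) = l}"

text \<open>Truncated subtraction makes the weight of a dead zone \<open>0\<close>.\<close>

definition weight :: "nat \<Rightarrow> 'e set \<Rightarrow> 'e set \<Rightarrow> 'z \<Rightarrow> nat" where
  "weight c M B z = c ^ card (hit B z) * (2 - card (threats M B z))"

definition potential :: "nat \<Rightarrow> 'e set \<Rightarrow> 'e set \<Rightarrow> nat" where
  "potential c M B = (\<Sum>z\<in>Z. weight c M B z)"

lemma finite_pr: "z \<in> Z \<Longrightarrow> i \<in> I \<Longrightarrow> finite (pr z i)"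
  using card_pr[of z i] card.infinite by fastforce

lemma finite_threats: "z \<in> Z \<Longrightarrow> finite (threats M B z)"
  unfolding threats_def using fin_I finite_pr by (intro finite_Int disjI2) auto

lemma finite_alive: "finite (alive M B)"
  using fin_Z by (simp add: alive_def)

text \<open>A new Maker element adds a threat in at most one zone, and one more threat lowers the
  weight of an alive zone by at most \<open>c ^ card (hit B z)\<close>, hence by at most
  \<open>c ^ L\<close>. Dead zones already weigh \<open>0\<close>.\<close>

lemma potential_maker_move:
  assumes fin_D: "finite D" and c: "c \<ge> 1"
    and lev: "\<And>z. z \<in> alive M B \<Longrightarrow> card (hit B z) \<le> L"
  shows "potential c M B \<le> potential c (M \<union> D) B + c ^ L * card D"
proof -
  let ?S = "\<lambda>z. \<Union>i\<in>I. pr z i"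
  have "weight c M B z \<le> weight c (M \<union> D) B z + c ^ L * card (D \<inter> ?S z)" if z: "z \<in> Z" for z
  proof (cases "z \<in> alive M B")
    case False
    then show ?thesis using z by (simp add: alive_def weight_def)
  next
    case True
    have "threats (M \<union> D) B z \<subseteq> threats M B z \<union> (D \<inter> ?S z)"
      by (auto simp: threats_def)
    then have "card (threats (M \<union> D) B z) \<le> card (threats M B z \<union> (D \<inter> ?S z))"
      using z fin_D by (intro card_mono) (auto simp: finite_threats)
    also have "\<dots> \<le> card (threats M B z) + card (D \<inter> ?S z)"
      by (rule card_Un_le)
    finally have "2 - card (threats M B z) \<le> 2 - card (threats (M \<union> D) B z) + card (D \<inter> ?S z)"
      by linarith
    then have "weight c M B z \<le>
        c ^ card (hit B z) * (2 - card (threats (M \<union> D) B z) + card (D \<inter> ?S z))"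
      unfolding weight_def by (rule mult_le_mono2)
    also have "\<dots> = weight c (M \<union> D) B z + c ^ card (hit B z) * card (D \<inter> ?S z)"
      by (simp add: weight_def distrib_left)
    also have "\<dots> \<le> weight c (M \<union> D) B z + c ^ L * card (D \<inter> ?S z)"
      using lev[OF True] c by (intro add_left_mono mult_le_mono1 power_increasing) auto
    finally show ?thesis .
  qed
  then have "potential c M B \<le> (\<Sum>z\<in>Z. weight c (M \<union> D) B z + c ^ L * card (D \<inter> ?S z))"
    unfolding potential_def by (intro sum_mono)
  also have "\<dots> = potential c (M \<union> D) B + c ^ L * (\<Sum>z\<in>Z. card (D \<inter> ?S z))"
    by (simp add: potential_def sum.distrib sum_distrib_left)
  also have "(\<Sum>z\<in>Z. card (D \<inter> ?S z)) \<le> card D"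
    using fin_Z fin_D pr_unique
    by (intro sum_card_Int_le) (fastforce simp: disjoint_family_on_def)+
  finally show ?thesis by simp
qed

text \<open>An alive zone has at most one threat; Breaker aims at the pair containing it, or at any
  unhit pair if there is none. Maker holds at most one of the two elements there, so a free one
  remains.\<close>

lemma touch_ex:
  assumes z: "z \<in> alive M B" and lev: "card (hit B z) < card I"
  shows "\<exists>i e. i \<in> I - hit B z \<and> e \<in> pr z i \<and> e \<notin> M \<and> threats M B z \<subseteq> pr z i"
proof -
  have zZ: "z \<in> Z" using z by (simp add: alive_def)
  have "hit B z \<noteq> I" using lev by auto
  then obtain i0 where i0: "i0 \<in> I - hit B z" by (auto simp: hit_def)
  have "\<exists>i\<in>I - hit B z. threats M B z \<subseteq> pr z i"
  proof (cases "threats M B z = {}")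
    case False
    then have "card (threats M B z) = 1"
      using z finite_threats[OF zZ, of M B] by (simp add: alive_def le_Suc_eq)
    then obtain f where f: "threats M B z = {f}" by (auto simp: card_1_singleton_iff)
    then show ?thesis by (auto simp: threats_def)
  qed (use i0 in auto)
  then obtain i where i: "i \<in> I - hit B z" "threats M B z \<subseteq> pr z i" by blast
  have "\<not> pr z i \<subseteq> M"
  proof
    assume "pr z i \<subseteq> M"
    then have "pr z i \<subseteq> threats M B z" using i by (auto simp: threats_def)
    then have "card (pr z i) \<le> card (threats M B z)"
      by (intro card_mono finite_threats zZ)
    then show False using z card_pr[OF zZ, of i] i by (simp add: alive_def)
  qed
  then show ?thesis using i by blast
qed

text \<open>Touches in distinct zones do not interact, since the pairs are disjoint. Each costs one
  element and hits the pair holding the only threat of its zone, if any, so no threat survives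
  there.\<close>

lemma breaker_touch:
  assumes T: "T \<subseteq> alive_at M B k" and k: "k < card I"
  shows "\<exists>C. C \<subseteq> (\<Union>z\<in>Z. \<Union>i\<in>I. pr z i) \<and> C \<inter> (M \<union> B) = {} \<and> card C = card T \<and>
    (\<forall>z\<in>T. card (hit (B \<union> C) z) = Suc k \<and> threats M (B \<union> C) z = {}) \<and>
    (\<forall>z\<in>Z - T. hit (B \<union> C) z = hit B z)"
proof -
  have T': "z \<in> alive M B" "card (hit B z) = k" "z \<in> Z" if "z \<in> T" for z
    using that T by (auto simp: alive_at_def alive_def)
  have "\<forall>z\<in>T. \<exists>i e. i \<in> I - hit B z \<and> e \<in> pr z i \<and> e \<notin> M \<and> threats M B z \<subseteq> pr z i"
    using touch_ex T' k by simp
  then obtain i e where ie: "\<forall>z\<in>T. i z \<in> I - hit B z \<and> e z \<in> pr z (i z) \<and> e z \<notin> M \<and>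
      threats M B z \<subseteq> pr z (i z)"
    by (auto simp only: bchoice_iff)
  have iT: "i z \<in> I" "i z \<notin> hit B z" and eT: "e z \<in> pr z (i z)" "e z \<notin> M" "e z \<notin> B"
    and thT: "threats M B z \<subseteq> pr z (i z)" if "z \<in> T" for z
    using bspec[OF ie that] by (auto simp: hit_def)
  \<comment> \<open>\<open>e w\<close> lies in no pair but the chosen one; this gives both
    injectivity of \<open>e\<close> and the exact change of \<open>hit\<close>.\<close>
  have e_unique: "z = w \<and> j = i w" if "z \<in> Z" "j \<in> I" "w \<in> T" "e w \<in> pr z j" for z w j
    using pr_unique[OF that(1,2) T'(3)[OF that(3)] iT(1)[OF that(3)] that(4) eT(1)[OF that(3)]] .
  define C where "C = e ` T"
  have inj: "inj_on e T"
  proof (rule inj_onI)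
    fix z w assume "z \<in> T" "w \<in> T" "e z = e w"
    then show "z = w" using e_unique[of z "i z" w] T'(3) iT(1) eT(1)[of z] by simp
  qed
  have hit_C: "hit (B \<union> C) z = hit B z \<union> (if z \<in> T then {i z} else {})" if z: "z \<in> Z" for z
  proof -
    have "j \<in> hit (B \<union> C) z \<longleftrightarrow> j \<in> hit B z \<or> z \<in> T \<and> j = i z" for j
    proof -
      have "j \<in> I \<and> (\<exists>w\<in>T. e w \<in> pr z j) \<longleftrightarrow> z \<in> T \<and> j = i z"
        using e_unique[OF z, of j] iT(1)[of z] eT(1)[of z] by blast
      then show ?thesis unfolding hit_def C_def by blast
    qed
    then show ?thesis by auto
  qed
  show ?thesis
  proof (intro exI[of _ C] conjI ballI)
    show "C \<subseteq> (\<Union>z\<in>Z. \<Union>i\<in>I. pr z i)"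
      using T'(3) iT(1) eT(1) unfolding C_def by blast
    show "C \<inter> (M \<union> B) = {}"
      using eT(2,3) unfolding C_def by blast
    show "card C = card T" using inj by (simp add: C_def card_image)
  next
    fix z assume z: "z \<in> T"
    have "finite (hit B z)" using fin_I by (simp add: hit_def)
    then show "card (hit (B \<union> C) z) = Suc k"
      using hit_C[OF T'(3)[OF z]] z iT(2)[OF z] T'(2)[OF z] by simp
    have "threats M (B \<union> C) z \<subseteq> threats M B z"
      using hit_C[OF T'(3)[OF z]] by (auto simp: threats_def)
    then have "threats M (B \<union> C) z \<subseteq> pr z (i z)" using thT[OF z] by (rule subset_trans)
    moreover have "f \<notin> pr z (i z)" if "f \<in> threats M (B \<union> C) z" for f
    proof
      assume f: "f \<in> pr z (i z)"
      from that obtain j where j: "j \<in> I" "j \<notin> hit (B \<union> C) z" "f \<in> pr z j"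
        by (auto simp: threats_def)
      have "i z = j" using pr_unique[OF T'(3)[OF z] iT(1)[OF z] T'(3)[OF z] j(1) f j(3)] ..
      then show False using j(2) hit_C[OF T'(3)[OF z]] z by simp
    qed
    ultimately show "threats M (B \<union> C) z = {}" by blast
  next
    fix z assume "z \<in> Z - T"
    then show "hit (B \<union> C) z = hit B z" using hit_C[of z] by simp
  qed
qed

definition breaker_complete :: "'e set \<Rightarrow> bool" where
  "breaker_complete B \<longleftrightarrow> (\<exists>z\<in>Z. hit B z = I)"

lemma breaker_complete_mono:
  assumes "breaker_complete B" "B \<subseteq> B'"
  shows "breaker_complete B'"
proof -
  obtain z where z: "z \<in> Z" "hit B z = I" using assms(1) by (auto simp: breaker_complete_def)
  moreover have "hit B z \<subseteq> hit B' z" "hit B' z \<subseteq> I" using assms(2) by (auto simp: hit_def)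
  ultimately show ?thesis by (auto simp: breaker_complete_def)
qed

text \<open>Describes a position with Breaker to move. The threshold is the bound of
  \<open>potential_le\<close>, so while no zone is complete it forces a level with at least
  \<open>q\<close> alive zones. The witness \<open>k\<close> is the level used in Breaker's last
  turn, or \<open>0\<close> at the start.\<close>

definition breaker_inv :: "nat \<Rightarrow> 'e set \<Rightarrow> 'e set \<Rightarrow> bool" where
  "breaker_inv q M B \<longleftrightarrow> breaker_complete B \<or>
     potential (2 * q) M B > 2 * q * card I * (2 * q) ^ card I \<and>
     (\<exists>k. (\<forall>z\<in>alive M B. card (hit B z) \<le> Suc k) \<and> (\<forall>j<k. card (alive_at M B j) < q))"

text \<open>Initially every zone weighs \<open>2\<close>, and each element of Maker's first move
  costs at most \<open>1\<close> because all levels are \<open>0\<close>. The initial potential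
  exceeds the threshold by at least \<open>2 * q\<close>, which is more than
  \<open>card D\<close>.\<close>

lemma breaker_inv_init:
  assumes D: "finite D" "card D < 2 * q" and big: "card Z \<ge> q * card I * (2 * q) ^ card I + q"
  shows "breaker_inv q D {}"
proof -
  have hit0: "hit {} z = {}" for z by (simp add: hit_def)
  have "2 * card Z = potential (2 * q) {} {}"
    by (simp add: potential_def weight_def hit0 threats_def)
  also have "\<dots> \<le> potential (2 * q) ({} \<union> D) {} + (2 * q) ^ 0 * card D"
    using D by (intro potential_maker_move) (auto simp: hit0)
  finally have "2 * card Z \<le> potential (2 * q) D {} + card D" by simp
  then have "potential (2 * q) D {} > 2 * q * card I * (2 * q) ^ card I"
    using D(2) big by simp
  then show ?thesis by (auto simp: breaker_inv_def hit0)
qed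

text \<open>All alive zones are on levels below \<open>card I\<close>, so there are at most
  \<open>q * card I\<close> of them, each of weight at most \<open>2 * c ^ card I\<close>.\<close>

lemma potential_le:
  assumes c: "c \<ge> 1" and few: "\<And>j. j < card I \<Longrightarrow> card (alive_at M B j) \<le> q"
    and lev: "\<And>z. z \<in> alive M B \<Longrightarrow> card (hit B z) < card I"
  shows "potential c M B \<le> 2 * q * card I * c ^ card I"
proof -
  have "alive M B = (\<Union>j<card I. alive_at M B j)"
    using lev by (auto simp: alive_at_def)
  then have "card (alive M B) \<le> (\<Sum>j<card I. card (alive_at M B j))"
    by (simp add: card_UN_le)
  also have "\<dots> \<le> q * card I"
    using sum_bounded_above[of "{..<card I}" "\<lambda>j. card (alive_at M B j)" q] few
    by (simp add: mult.commute)
  finally have al: "card (alive M B) \<le> q * card I" .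
  have "potential c M B = (\<Sum>z\<in>alive M B. weight c M B z)"
    unfolding potential_def using fin_Z
    by (intro sum.mono_neutral_right) (auto simp: alive_def weight_def)
  also have "\<dots> \<le> (\<Sum>z\<in>alive M B. c ^ card I * 2)"
    unfolding weight_def using c lev
    by (intro sum_mono mult_le_mono power_increasing) (auto intro: less_imp_le)
  also have "\<dots> \<le> q * card I * (c ^ card I * 2)"
    using al by simp
  finally show ?thesis by (simp add: mult_ac)
qed

text \<open>One full round: the reply \<open>C\<close> is fixed before Maker's move
  \<open>D\<close>, so the invariant has to survive every \<open>D\<close>.\<close>

lemma breaker_inv_step:
  assumes inv: "breaker_inv q M B" and open_game: "\<not> breaker_complete B" and q: "q \<ge> 1"
  shows "\<exists>C. C \<subseteq> (\<Union>z\<in>Z. \<Union>i\<in>I. pr z i) \<and> C \<inter> (M \<union> B) = {} \<and> card C = q \<and>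
    (\<forall>D. finite D \<and> card D < 2 * q \<longrightarrow> breaker_inv q (M \<union> D) (B \<union> C))"
proof -
  define c where "c = 2 * q"
  have c: "c \<ge> 1" using q by (simp add: c_def)
  from inv open_game obtain k0 where
    pot: "potential c M B > 2 * q * card I * c ^ card I"
    and k0: "\<And>z. z \<in> alive M B \<Longrightarrow> card (hit B z) \<le> Suc k0"
      "\<And>j. j < k0 \<Longrightarrow> card (alive_at M B j) < q"
    by (auto simp: breaker_inv_def c_def)
  have lev: "card (hit B z) < card I" if "z \<in> alive M B" for z
  proof -
    have "hit B z \<subseteq> I" by (auto simp: hit_def)
    moreover have "hit B z \<noteq> I" using open_game that by (auto simp: breaker_complete_def alive_def)
    ultimately show ?thesis using fin_I by (intro psubset_card_mono) auto
  qed
  \<comment> \<open>If every level held fewer than \<open>q\<close> alive zones,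
    \<open>potential_le\<close> would contradict the threshold.\<close>
  have ex: "\<exists>j. j < card I \<and> card (alive_at M B j) \<ge> q"
    using potential_le[where q = q, OF c _ lev] pot by (meson leI less_imp_le not_le)
  define k where "k = (LEAST j. j < card I \<and> card (alive_at M B j) \<ge> q)"
  have k: "k < card I" "card (alive_at M B k) \<ge> q"
    using LeastI_ex[OF ex] by (auto simp: k_def)
  have few: "card (alive_at M B j) < q" if "j < k" for j
    using not_less_Least[of j "\<lambda>j. j < card I \<and> card (alive_at M B j) \<ge> q"] that k(1)
    by (auto simp: k_def not_le)
  \<comment> \<open>Levels below \<open>k0\<close> are too sparse to be chosen, so the level used
    never decreases and the bound \<open>Suc k0\<close> may be raised to
    \<open>Suc k\<close>.\<close>
  have "k0 \<le> k" using k(2) k0(2) by (meson leI not_le)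
  then have lev': "card (hit B z) \<le> Suc k" if "z \<in> alive M B" for z
    using k0(1)[OF that] by linarith
  obtain T where T: "T \<subseteq> alive_at M B k" "card T = q" "finite T"
    using obtain_subset_with_card_n[OF k(2)] by blast
  then have TZ: "T \<subseteq> Z" by (auto simp: alive_at_def alive_def)
  from breaker_touch[OF T(1) k(1)] T(2) obtain C where
    C: "C \<subseteq> (\<Union>z\<in>Z. \<Union>i\<in>I. pr z i)" "C \<inter> (M \<union> B) = {}" "card C = q"
    and C_T: "\<And>z. z \<in> T \<Longrightarrow> card (hit (B \<union> C) z) = Suc k \<and> threats M (B \<union> C) z = {}"
    and C_not_T: "\<And>z. z \<in> Z - T \<Longrightarrow> hit (B \<union> C) z = hit B z"
    by auto
  have alive_sub: "alive M (B \<union> C) - T \<subseteq> alive M B - T"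
    using C_not_T by (auto simp: alive_def threats_def)
  have lev_C: "card (hit (B \<union> C) z) \<le> Suc k" if z: "z \<in> alive M (B \<union> C)" for z
  proof (cases "z \<in> T")
    case False
    then have "z \<in> alive M B" "z \<in> Z - T" using alive_sub z by (auto simp: alive_def)
    then show ?thesis using lev' C_not_T by simp
  qed (simp add: C_T)
  \<comment> \<open>Before the touch the zone weighs at most \<open>2 * c ^ k\<close>; afterwards it
    has no threat and weighs exactly \<open>2 * c ^ Suc k\<close>.\<close>
  have weight_T: "weight c M (B \<union> C) z + 2 * c ^ k \<ge> weight c M B z + 2 * c ^ Suc k" if "z \<in> T" for z
    using C_T[OF that] T(1) that by (auto simp: weight_def alive_at_def)
  have weight_not_T: "weight c M (B \<union> C) z = weight c M B z" if "z \<in> Z - T" for z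
    using C_not_T[OF that] by (simp add: weight_def threats_def)
  have "potential c M B + q * (2 * c ^ Suc k)
      = (\<Sum>z\<in>Z - T. weight c M B z) + (\<Sum>z\<in>T. weight c M B z + 2 * c ^ Suc k)"
    unfolding potential_def using sum.subset_diff[OF TZ fin_Z, of "weight c M B"] T(2)
    by (simp add: sum.distrib)
  also have "\<dots> \<le> (\<Sum>z\<in>Z - T. weight c M (B \<union> C) z) + (\<Sum>z\<in>T. weight c M (B \<union> C) z + 2 * c ^ k)"
    using sum_mono[OF weight_T] by (simp add: weight_not_T)
  also have "\<dots> = potential c M (B \<union> C) + q * (2 * c ^ k)"
    unfolding potential_def using sum.subset_diff[OF TZ fin_Z, of "weight c M (B \<union> C)"] T(2)
    by (simp add: sum.distrib)
  \<comment> \<open>Here \<open>c = 2 * q\<close> turns \<open>q * (2 * c ^ k)\<close> into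
    \<open>c ^ Suc k\<close>.\<close>
  finally have gain: "potential c M B + q * (2 * c ^ Suc k) \<le> potential c M (B \<union> C) + c ^ Suc k"
    by (simp add: c_def mult_ac)
  have "breaker_inv q (M \<union> D) (B \<union> C)" if D: "finite D" "card D < 2 * q" for D
  proof -
    have mono: "alive (M \<union> D) (B \<union> C) \<subseteq> alive M (B \<union> C)"
    proof
      fix z assume z: "z \<in> alive (M \<union> D) (B \<union> C)"
      then have "card (threats M (B \<union> C) z) \<le> card (threats (M \<union> D) (B \<union> C) z)"
        by (intro card_mono finite_threats) (auto simp: alive_def threats_def)
      then show "z \<in> alive M (B \<union> C)" using z by (auto simp: alive_def)
    qed
    have "potential c M (B \<union> C) \<le> potential c (M \<union> D) (B \<union> C) + c ^ Suc k * card D"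
      using D(1) c lev_C by (rule potential_maker_move)
    moreover have "c ^ Suc k * card D + c ^ Suc k \<le> q * (2 * c ^ Suc k)"
      using mult_le_mono2[of "card D + 1" "2 * q" "c ^ Suc k"] D(2) by (simp add: algebra_simps)
    ultimately have "potential c (M \<union> D) (B \<union> C) \<ge> potential c M B"
      using gain by linarith
    \<comment> \<open>Touched zones have moved to level \<open>Suc k\<close> and the others kept
      theirs, so no level below \<open>k\<close> gains an alive zone.\<close>
    moreover have "card (alive_at (M \<union> D) (B \<union> C) j) < q" if j: "j < k" for j
    proof -
      have "alive_at (M \<union> D) (B \<union> C) j \<subseteq> alive_at M B j"
      proof
        fix z assume z: "z \<in> alive_at (M \<union> D) (B \<union> C) j"
        then have zC: "z \<in> alive M (B \<union> C)" using mono by (auto simp: alive_at_def)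
        have "z \<notin> T" using z C_T j by (auto simp: alive_at_def)
        then show "z \<in> alive_at M B j"
          using z zC alive_sub C_not_T[of z] by (auto simp: alive_at_def alive_def)
      qed
      then have "card (alive_at (M \<union> D) (B \<union> C) j) \<le> card (alive_at M B j)"
        using finite_alive by (intro card_mono) (auto simp: alive_at_def)
      then show ?thesis using few[OF j] by simp
    qed
    ultimately show ?thesis
      using pot lev_C mono unfolding breaker_inv_def c_def
      by (intro disjI2 conjI exI[of _ k]) auto
  qed
  then show ?thesis using C by blast
qed

end

section \<open>Claimed edges along a history\<close>

definition breaker_claimed :: "history \<Rightarrow> edge set" where
  "breaker_claimed h = \<Union> {h ! i | i. i < length h \<and> odd i}"

lemma claimed_Nil [simp]: "maker_claimed [] = {}" "breaker_claimed [] = {}"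
  by (auto simp: maker_claimed_def breaker_claimed_def)

lemma claimed_snoc:
  "maker_claimed (h @ [C]) = (if even (length h) then maker_claimed h \<union> C else maker_claimed h)"
  "breaker_claimed (h @ [C]) = (if odd (length h) then breaker_claimed h \<union> C else breaker_claimed h)"
  by (auto simp: maker_claimed_def breaker_claimed_def nth_append less_Suc_eq split: if_splits)

lemma Union_history: "\<Union> (set h) = maker_claimed h \<union> breaker_claimed h"
  unfolding maker_claimed_def breaker_claimed_def in_set_conv_nth by (auto 4 4 simp: set_conv_nth)

lemma breaker_claimed_append: "breaker_claimed h \<subseteq> breaker_claimed (h @ h')"
  by (fastforce simp: breaker_claimed_def nth_append)

lemma legal_history_snoc:
  "legal_history p q m n (h @ [C]) \<longleftrightarrow> legal_history p q m n h \<and> legal_move p q m n h C"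
  by (auto simp: legal_history_def nth_append less_Suc_eq)

lemma legal_history_disjoint:
  "legal_history p q m n h \<Longrightarrow> maker_claimed h \<inter> breaker_claimed h = {}"
proof (induction h rule: rev_induct)
  case (snoc C h)
  then show ?case
    by (auto simp: legal_history_snoc claimed_snoc legal_move_def unclaimed_def Union_history)
qed simp

section \<open>Adjacency and edges of the grid\<close>

lemma grid_adjacent_iff:
  "grid_adjacent (x, y) (x', y') \<longleftrightarrow>
     x = x' \<and> (y' = Suc y \<or> y = Suc y') \<or> y = y' \<and> (x' = Suc x \<or> x = Suc x')"
proof -
  \<comment> \<open>Coordinate differences are integers, so distance one means that two integer
    squares sum to \<open>1\<close>: one difference vanishes and the other is a unit.\<close>
  define a b where "a = int x - int x'" and "b = int y - int y'"
  have "grid_adjacent (x, y) (x', y') \<longleftrightarrow> (real_of_int a)\<^sup>2 + (real_of_int b)\<^sup>2 = 1"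
    by (simp add: grid_adjacent_def dist_prod_def dist_real_def a_def b_def)
  also have "\<dots> \<longleftrightarrow> real_of_int (a\<^sup>2 + b\<^sup>2) = real_of_int 1"
    by simp
  also have "\<dots> \<longleftrightarrow> a\<^sup>2 + b\<^sup>2 = 1"
    by (rule of_int_eq_iff)
  also have "\<dots> \<longleftrightarrow> a = 0 \<and> \<bar>b\<bar> = 1 \<or> b = 0 \<and> \<bar>a\<bar> = 1"
  proof
    assume eq: "a\<^sup>2 + b\<^sup>2 = 1"
    have "a\<^sup>2 \<ge> 0" "b\<^sup>2 \<ge> 0" by simp_all
    then have "a\<^sup>2 \<le> 1" "b\<^sup>2 \<le> 1" using eq by linarith+
    then have "\<bar>a\<bar> \<le> 1" "\<bar>b\<bar> \<le> 1" by (simp_all add: abs_square_le_1)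
    then have "a = -1 \<or> a = 0 \<or> a = 1" "b = -1 \<or> b = 0 \<or> b = 1" by linarith+
    then show "a = 0 \<and> \<bar>b\<bar> = 1 \<or> b = 0 \<and> \<bar>a\<bar> = 1" using eq by (elim disjE) simp_all
  next
    assume "a = 0 \<and> \<bar>b\<bar> = 1 \<or> b = 0 \<and> \<bar>a\<bar> = 1"
    then show "a\<^sup>2 + b\<^sup>2 = 1"
      using power2_abs[of a] power2_abs[of b] by (elim disjE conjE) simp_all
  qed
  also have "\<dots> \<longleftrightarrow>
      x = x' \<and> (y' = Suc y \<or> y = Suc y') \<or> y = y' \<and> (x' = Suc x \<or> x = Suc x')"
    unfolding a_def b_def by linarith
  finally show ?thesis .
qed

lemma grid_edges_iff:
  "{u, v} \<in> grid_edges m n \<longleftrightarrow> u \<in> grid_vertices m n \<and> v \<in> grid_vertices m n \<and> grid_adjacent u v"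
proof -
  have "grid_adjacent v u \<Longrightarrow> grid_adjacent u v" for u v
    by (simp add: grid_adjacent_def dist_commute)
  then show ?thesis unfolding grid_edges_def mem_Collect_eq doubleton_eq_iff by blast
qed

lemma finite_grid_edges: "finite (grid_edges m n)"
proof (rule finite_subset)
  show "grid_edges m n \<subseteq> Pow (grid_vertices m n)" by (auto simp: grid_edges_def)
qed (simp add: grid_vertices_def)

section \<open>Existence of moves and exhaustion of the board\<close>

lemma legal_move_ex: "\<exists>C. legal_move p q m n h C"
proof -
  have "(min (if even (length h) then p else q) (card (unclaimed m n h))) \<le> card (unclaimed m n h)"
    by simp
  from obtain_subset_with_card_n[OF this] show ?thesis
    unfolding legal_move_def by metis
qed

text \<open>While edges remain, each Breaker turn removes at least one. The index is odd so that the
  full board is found with Breaker to move, where the invariant is available.\<close>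

lemma exhausted_ex:
  assumes play: "legal_play p q m n f" and q: "q \<ge> 1"
  shows "\<exists>t. odd t \<and> unclaimed m n (map f [0..<t]) = {}"
proof -
  let ?u = "\<lambda>t. unclaimed m n (map f [0..<t])"
  have fin: "finite (?u t)" for t by (simp add: unclaimed_def finite_grid_edges)
  have step: "?u (Suc t) = ?u t - f t" for t
    by (auto simp: unclaimed_def)
  have "card (?u (2 * s + 1)) \<le> card (grid_edges m n) - s" for s
  proof (induction s)
    case 0
    show ?case by (auto simp: unclaimed_def finite_grid_edges intro: card_mono)
  next
    case (Suc s)
    have "legal_move p q m n (map f [0..<2 * s + 1]) (f (2 * s + 1))"
      using play unfolding legal_play_def by blast
    then have sub: "f (2 * s + 1) \<subseteq> ?u (2 * s + 1)"
      and card: "card (f (2 * s + 1)) = min q (card (?u (2 * s + 1)))"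
      by (auto simp: legal_move_def)
    have "card (?u (2 * s + 2)) = card (?u (2 * s + 1)) - card (f (2 * s + 1))"
      using step[of "2 * s + 1"] card_Diff_subset[OF finite_subset[OF sub fin] sub] by simp
    then have "card (?u (2 * s + 2)) \<le> card (?u (2 * s + 1)) - 1"
      using card q by linarith
    moreover have "card (?u (2 * s + 3)) \<le> card (?u (2 * s + 2))"
      using step[of "2 * s + 2"] card_mono[OF fin, of "?u (2 * s + 3)" "2 * s + 2"]
      by (simp add: numeral_3_eq_3)
    ultimately show ?case using Suc by (simp add: numeral_3_eq_3)
  qed
  from this[of "card (grid_edges m n)"] have "card (?u (2 * card (grid_edges m n) + 1)) = 0"
    by simp
  then have "?u (2 * card (grid_edges m n) + 1) = {}"
    using card_0_eq[OF fin] by blast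
  then show ?thesis by (intro exI[of _ "2 * card (grid_edges m n) + 1"] conjI) simp_all
qed

section \<open>Zones, owners and crossing paths\<close>

text \<open>The pair owned by the vertex in row \<open>y\<close> and in the \<open>x\<close>-th inner column of the zone whose
  leftmost column is \<open>a\<close>. Vertices below the antidiagonal \<open>x + y = n + 1\<close> own their left and upper
  edges, those on it their left and right edges, those above it their lower and right edges.\<close>

definition zone_pair :: "nat \<Rightarrow> nat \<Rightarrow> nat \<times> nat \<Rightarrow> edge set" where
  "zone_pair n a = (\<lambda>(x, y).
     {{(a + x, y), if x + y \<le> Suc n then (a + x - 1, y) else (a + x, y - 1)},
      {(a + x, y), if x + y \<le> n then (a + x, Suc y) else (Suc (a + x), y)}})"

lemma card_zone_pair:
  assumes "i \<in> {1..n} \<times> {1..n}"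
  shows "card (zone_pair n a i) = 2"
proof -
  obtain x y where i: "i = (x, y)" by force
  have "x \<ge> 1" "y \<ge> 1" using assms by (auto simp: i)
  moreover from this have "a + x - Suc 0 \<noteq> Suc (a + x)" by linarith
  ultimately show ?thesis by (simp add: i zone_pair_def card_insert_if doubleton_eq_iff)
qed

text \<open>Replaces truncated subtraction by successor equations, so that linear arithmetic settles
  later case analyses. The disjuncts are the left, lower, upper and right edge, in this
  order.\<close>

lemma zone_pairE:
  assumes "i \<in> {1..n} \<times> {1..n}" "e \<in> zone_pair n a i"
  obtains x y x' y' where "i = (x, y)" "1 \<le> x" "x \<le> n" "1 \<le> y" "y \<le> n"
    "e = {(a + x, y), (x', y')}"
    "y' = y \<and> Suc x' = a + x \<and> x + y \<le> Suc n \<or> x' = a + x \<and> Suc y' = y \<and> x + y > Suc n \<or>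
     x' = a + x \<and> y' = Suc y \<and> x + y \<le> n \<or> y' = y \<and> x' = Suc (a + x) \<and> x + y > n"
proof -
  obtain x y where i: "i = (x, y)" by force
  have bounds: "1 \<le> x" "x \<le> n" "1 \<le> y" "y \<le> n" using assms(1) by (auto simp: i)
  from assms(2) consider
    "e = {(a + x, y), (a + x - 1, y)}" "x + y \<le> Suc n" | "e = {(a + x, y), (a + x, y - 1)}" "x + y > Suc n" |
    "e = {(a + x, y), (a + x, Suc y)}" "x + y \<le> n" | "e = {(a + x, y), (Suc (a + x), y)}" "x + y > n"
    unfolding i zone_pair_def by (auto split: if_splits)
  then show ?thesis
    by cases (rule that[OF i bounds], assumption, use bounds in simp)+
qed

text \<open>A vertex with \<open>y = 1\<close> owns no lower edge, since
  \<open>x + y \<le> Suc n\<close>, and one with \<open>y = n\<close> no upper edge, since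
  \<open>x + y > n\<close>; so the pairs stay on the board.\<close>

lemma zone_pair_subset:
  assumes "i \<in> {1..n} \<times> {1..n}" "1 \<le> a" "a + n < m"
  shows "zone_pair n a i \<subseteq> grid_edges m n"
proof
  fix e assume "e \<in> zone_pair n a i"
  with assms(1) obtain x y x' y' where xy: "1 \<le> x" "x \<le> n" "1 \<le> y" "y \<le> n"
    and e: "e = {(a + x, y), (x', y')}"
    and nb: "y' = y \<and> Suc x' = a + x \<and> x + y \<le> Suc n \<or> x' = a + x \<and> Suc y' = y \<and> x + y > Suc n \<or>
      x' = a + x \<and> y' = Suc y \<and> x + y \<le> n \<or> y' = y \<and> x' = Suc (a + x) \<and> x + y > n"
    by (rule zone_pairE)
  have "1 \<le> x' \<and> x' \<le> m \<and> 1 \<le> y' \<and> y' \<le> n" using nb xy assms(2,3) by linarith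
  moreover have "grid_adjacent (a + x, y) (x', y')" using nb unfolding grid_adjacent_iff by linarith
  ultimately show "e \<in> grid_edges m n"
    using xy assms(3) unfolding e grid_edges_iff grid_vertices_def by simp
qed

lemma zone_pair_columns:
  assumes "i \<in> {1..n} \<times> {1..n}" "e \<in> zone_pair n a i"
  shows "e \<noteq> {}" "v \<in> e \<Longrightarrow> a \<le> fst v \<and> fst v \<le> Suc (a + n)"
proof -
  from assms obtain x y x' y' where x: "1 \<le> x" "x \<le> n" and e: "e = {(a + x, y), (x', y')}"
    and nb: "y' = y \<and> Suc x' = a + x \<and> x + y \<le> Suc n \<or> x' = a + x \<and> Suc y' = y \<and> x + y > Suc n \<or>
      x' = a + x \<and> y' = Suc y \<and> x + y \<le> n \<or> y' = y \<and> x' = Suc (a + x) \<and> x + y > n"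
    by (rule zone_pairE)
  have "a \<le> x' \<and> x' \<le> Suc (a + n)" using nb x by linarith
  then show "e \<noteq> {}" "v \<in> e \<Longrightarrow> a \<le> fst v \<and> fst v \<le> Suc (a + n)" using e x by auto
qed

text \<open>Let \<open>(a + x, y)\<close> be the left or lower end of an edge. If
  \<open>x + y \<le> n\<close>, a horizontal edge belongs to its right end and a vertical one to its
  lower end; otherwise each belongs to the opposite end. So the two ends never both own it.\<close>

lemma zone_pair_unique:
  assumes i: "i \<in> {1..n} \<times> {1..n}" "e \<in> zone_pair n a i"
    and j: "j \<in> {1..n} \<times> {1..n}" "e \<in> zone_pair n a j"
  shows "i = j"
proof -
  from i obtain x y x' y' where "i = (x, y)" and e: "e = {(a + x, y), (x', y')}"
    "y' = y \<and> Suc x' = a + x \<and> x + y \<le> Suc n \<or> x' = a + x \<and> Suc y' = y \<and> x + y > Suc n \<or>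
     x' = a + x \<and> y' = Suc y \<and> x + y \<le> n \<or> y' = y \<and> x' = Suc (a + x) \<and> x + y > n"
    by (rule zone_pairE)
  moreover from j obtain v w v' w' where "j = (v, w)" and e': "e = {(a + v, w), (v', w')}"
    "w' = w \<and> Suc v' = a + v \<and> v + w \<le> Suc n \<or> v' = a + v \<and> Suc w' = w \<and> v + w > Suc n \<or>
     v' = a + v \<and> w' = Suc w \<and> v + w \<le> n \<or> w' = w \<and> v' = Suc (a + v) \<and> v + w > n"
    by (rule zone_pairE)
  moreover have "a + x = a + v \<and> y = w \<or> a + x = v' \<and> y = w' \<and> x' = a + v \<and> y' = w"
    using e(1) e'(1) by (auto simp: doubleton_eq_iff)
  moreover have "\<not> (a + x = v' \<and> y = w' \<and> x' = a + v \<and> y' = w)"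
    using e(2) e'(2) by linarith
  ultimately show ?thesis by simp
qed

text \<open>The test \<open>x + y \<le> n\<close> succeeds for \<open>x = 0\<close> and fails for
  \<open>x = n\<close>, so the owner of a horizontal edge is never in a border column. The
  assumption \<open>inner\<close> leaves out only the vertical edges within the two border
  columns.\<close>

lemma zone_pair_owner:
  assumes edge: "{u, v} \<in> grid_edges m n"
    and u: "a \<le> fst u" "fst u \<le> Suc (a + n)" and v: "a \<le> fst v" "fst v \<le> Suc (a + n)"
    and inner: "fst u \<noteq> fst v \<or> a < fst u \<and> fst u \<le> a + n"
  shows "\<exists>w\<in>{u, v}. (fst w - a, snd w) \<in> {1..n} \<times> {1..n} \<and> a < fst w \<and>
    {u, v} \<in> zone_pair n a (fst w - a, snd w)"
proof -
  let ?own = "\<lambda>w. (fst w - a, snd w) \<in> {1..n} \<times> {1..n} \<and> a < fst w \<and>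
    {u, v} \<in> zone_pair n a (fst w - a, snd w)"
  have horizontal: "?own (a + x, y) \<or> ?own (Suc (a + x), y)"
    if "{u, v} = {(a + x, y), (Suc (a + x), y)}" "x \<le> n" "1 \<le> y" "y \<le> n" for x y
  proof (cases "x + y \<le> n")
    case True
    then have "?own (Suc (a + x), y)" using that by (auto simp: zone_pair_def)
    then show ?thesis ..
  next
    case False
    then have "?own (a + x, y)" using that by (auto simp: zone_pair_def)
    then show ?thesis ..
  qed
  have vertical: "?own (a + x, y) \<or> ?own (a + x, Suc y)"
    if "{u, v} = {(a + x, y), (a + x, Suc y)}" "1 \<le> x" "x \<le> n" "1 \<le> y" "Suc y \<le> n" for x y
  proof (cases "x + y \<le> n")
    case True
    then have "?own (a + x, y)" using that by (auto simp: zone_pair_def)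
    then show ?thesis ..
  next
    case False
    then have "?own (a + x, Suc y)" using that by (auto simp: zone_pair_def)
    then show ?thesis ..
  qed
  obtain x y x' y' where uv: "u = (a + x, y)" "v = (a + x', y')"
    using u v by (metis le_add_diff_inverse prod.collapse)
  have rows: "1 \<le> y" "y \<le> n" "1 \<le> y'" "y' \<le> n"
    and adj: "x = x' \<and> (y' = Suc y \<or> y = Suc y') \<or> y = y' \<and> (x' = Suc x \<or> x = Suc x')"
    using edge by (auto simp: uv grid_edges_iff grid_vertices_def grid_adjacent_iff)
  have cols: "x \<le> Suc n" "x' \<le> Suc n" "x \<noteq> x' \<or> 1 \<le> x \<and> x \<le> n"
    using u v inner by (auto simp: uv)
  from adj consider "x = x'" "y' = Suc y" | "x = x'" "y = Suc y'" | "y = y'" "x' = Suc x" | "y = y'" "x = Suc x'"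
    by blast
  then show ?thesis
  proof cases
    case 1 then show ?thesis using vertical[of x y] rows cols by (auto simp: uv)
  next
    case 2 then show ?thesis using vertical[of x y'] rows cols by (auto simp: uv insert_commute)
  next
    case 3 then show ?thesis using horizontal[of x y] rows cols by (auto simp: uv)
  next
    case 4 then show ?thesis using horizontal[of x' y] rows cols by (auto simp: uv insert_commute)
  qed
qed

lemma crossing_contains_zone_pair:
  assumes P: "left_right_crossing_path m n P" and a: "1 \<le> a" "a + n < m"
  shows "\<exists>i\<in>{1..n} \<times> {1..n}. zone_pair n a i \<subseteq> path_edges P"
proof -
  define X where "X t = fst (P ! t)" for t
  have P': "P \<noteq> []" "distinct P" "set P \<subseteq> grid_vertices m n"
    "successively (\<lambda>u v. {u, v} \<in> grid_edges m n) P" "X 0 = 1" "X (length P - 1) = m"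
    using P by (auto simp: left_right_crossing_path_def grid_path_def X_def hd_conv_nth last_conv_nth)
  have "n \<ge> 1" using P'(1,3) by (cases P) (auto simp: grid_vertices_def)
  have edge: "{P ! t, P ! Suc t} \<in> grid_edges m n" if "Suc t < length P" for t
    using P'(4) that by (simp add: successively_conv_nth)
  have stp: "X (Suc t) \<le> Suc (X t)" "X t \<le> Suc (X (Suc t))" if "Suc t < length P" for t
    using edge[OF that] unfolding X_def
    by (cases "P ! t"; cases "P ! Suc t"; auto simp: grid_edges_iff grid_adjacent_iff)+
  \<comment> \<open>\<open>j\<close> is the first index past the inner columns and \<open>i\<close>
    the last index before \<open>j\<close> at which the path is not yet in them, so strictly between
    \<open>i\<close> and \<open>j\<close> it stays inside.\<close>
  define j where "j = (LEAST j. j < length P \<and> X j > a + n)"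
  have ex: "\<exists>j. j < length P \<and> X j > a + n"
    using P'(1,6) a by (intro exI[of _ "length P - 1"]) auto
  have j: "j < length P" "X j > a + n" using LeastI_ex[OF ex] by (auto simp: j_def)
  have before_j: "X t \<le> a + n" if "t < j" for t
    using not_less_Least[of t "\<lambda>j. j < length P \<and> X j > a + n"] that j(1) by (auto simp: j_def)
  have "j > 0" using j(2) P'(5) a by (cases j) auto
  define i where "i = (GREATEST i. i < j \<and> X i \<le> a)"
  have i: "i < j" "X i \<le> a"
    using GreatestI_nat[of "\<lambda>i. i < j \<and> X i \<le> a" 0 j] \<open>j > 0\<close> P'(5) a by (auto simp: i_def)
  have after_i: "X t > a" if "i < t" "t < j" for t
    using Greatest_le_nat[of "\<lambda>i. i < j \<and> X i \<le> a" t j] that by (fastforce simp: i_def)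
  \<comment> \<open>A step changes the column by at most one, so it cannot jump over the inner
    columns.\<close>
  have "Suc i \<noteq> j" using stp(1)[of i] i j \<open>n \<ge> 1\<close> by auto
  then have ij: "Suc i < j" using i(1) by simp
  have Xi: "X i = a" using stp(1)[of i] after_i[of "Suc i"] ij i j by simp
  have Xj: "X j = Suc (a + n)" using stp(1)[of "j - 1"] before_j[of "j - 1"] ij j by simp
  let ?own = "\<lambda>t. (X t - a, snd (P ! t))"
  \<comment> \<open>Each edge of the stretch is assigned the path index of its owner:
    \<open>j - i\<close> edges, but only \<open>j - i - 1\<close> inner indices.\<close>
  have "\<forall>t\<in>{i..<j}. \<exists>s. s \<in> {i<..<j} \<and> (s = t \<or> s = Suc t) \<and>
      ?own s \<in> {1..n} \<times> {1..n} \<and> {P ! t, P ! Suc t} \<in> zone_pair n a (?own s)"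
  proof
    fix t assume t: "t \<in> {i..<j}"
    have rng: "a \<le> X s" "X s \<le> Suc (a + n)" if "s \<in> {i..j}" for s
      using that Xi Xj before_j[of s] after_i[of s] by (cases "s = i"; cases "s = j"; auto)+
    have inner: "a < X s \<and> X s \<le> a + n \<longleftrightarrow> i < s \<and> s < j" if "s \<in> {i..j}" for s
      using that Xi Xj before_j[of s] after_i[of s] by (cases "s = i"; cases "s = j") auto
    have t': "Suc t < length P" "t \<in> {i..j}" "Suc t \<in> {i..j}" using t j(1) by auto
    have "X t \<noteq> X (Suc t) \<or> a < X t \<and> X t \<le> a + n"
      using inner[of t] inner[of "Suc t"] t ij by auto
    then have "\<exists>w\<in>{P ! t, P ! Suc t}. (fst w - a, snd w) \<in> {1..n} \<times> {1..n} \<and> a < fst w \<and>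
        {P ! t, P ! Suc t} \<in> zone_pair n a (fst w - a, snd w)"
      using rng[OF t'(2)] rng[OF t'(3)] unfolding X_def
      by (intro zone_pair_owner[OF edge[OF t'(1)]])
    then obtain s where s: "s = t \<or> s = Suc t" "?own s \<in> {1..n} \<times> {1..n}" "a < X s"
        "{P ! t, P ! Suc t} \<in> zone_pair n a (?own s)"
      unfolding X_def by blast
    have "X s \<le> a + n" "s \<in> {i..j}" using s(1-3) t by auto
    then have "s \<in> {i<..<j}" using inner[of s] s(3) by simp
    then show "\<exists>s. s \<in> {i<..<j} \<and> (s = t \<or> s = Suc t) \<and>
      ?own s \<in> {1..n} \<times> {1..n} \<and> {P ! t, P ! Suc t} \<in> zone_pair n a (?own s)"
      using s by blast
  qed
  from bchoice[OF this] obtain s where s: "s t \<in> {i<..<j}" "s t = t \<or> s t = Suc t"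
      "?own (s t) \<in> {1..n} \<times> {1..n}" "{P ! t, P ! Suc t} \<in> zone_pair n a (?own (s t))"
    if "t \<in> {i..<j}" for t
    by blast
  have "\<not> inj_on s {i..<j}"
  proof (rule pigeonhole)
    have "s ` {i..<j} \<subseteq> {i<..<j}" using s by blast
    then have "card (s ` {i..<j}) \<le> card {i<..<j}" by (intro card_mono) auto
    then show "card (s ` {i..<j}) < card {i..<j}" using ij by simp
  qed
  \<comment> \<open>As \<open>s t\<close> is \<open>t\<close> or \<open>Suc t\<close>, a collision
    comes from two consecutive edges meeting at index \<open>Suc t\<close>.\<close>
  then obtain t t' where "t \<in> {i..<j}" "t' \<in> {i..<j}" "s t = s t'" "t < t'"
    by (metis (no_types, lifting) inj_onI linorder_neqE_nat)
  moreover from this have "t' = Suc t" "s t = Suc t" using s[of t] s[of t'] by auto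
  ultimately have t: "t \<in> {i..<j}" "Suc t \<in> {i..<j}" "s t = Suc t" "s (Suc t) = Suc t" by auto
  let ?i = "?own (Suc t)"
  have mem: "?i \<in> {1..n} \<times> {1..n}" "{P ! t, P ! Suc t} \<in> zone_pair n a ?i"
    "{P ! Suc t, P ! Suc (Suc t)} \<in> zone_pair n a ?i"
    using s[OF t(1)] s[OF t(2)] t by auto
  \<comment> \<open>Path vertices are distinct, so these are two different edges and they fill the
    two-element pair.\<close>
  have "P ! t \<noteq> P ! Suc t" "P ! t \<noteq> P ! Suc (Suc t)"
    using t j(1) P'(2) by (auto simp: nth_eq_iff_index_eq)
  then have ne: "{P ! t, P ! Suc t} \<noteq> {P ! Suc t, P ! Suc (Suc t)}" by (auto simp: doubleton_eq_iff)
  have "{{P ! t, P ! Suc t}, {P ! Suc t, P ! Suc (Suc t)}} = zone_pair n a ?i"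
  proof (rule card_subset_eq)
    show "finite (zone_pair n a ?i)" by (simp add: zone_pair_def)
    show "card {{P ! t, P ! Suc t}, {P ! Suc t, P ! Suc (Suc t)}} = card (zone_pair n a ?i)"
      unfolding card_zone_pair[OF mem(1)] using ne by (simp only: card_2_iff) blast
  qed (use mem in simp)
  then have "zone_pair n a ?i = {{P ! t, P ! Suc t}, {P ! Suc t, P ! Suc (Suc t)}}" ..
  also have "\<dots> \<subseteq> path_edges P"
    using t j(1) by (auto simp: path_edges_def)
  finally show ?thesis using mem(1) by blast
qed

section \<open>Breaker's strategy on the board\<close>

theorem theorem1p2:
  fixes n q :: nat
  shows "\<exists>m0::nat. \<forall>(p::nat) (m::nat).
    int p \<le> 2 * int q - 1 \<and> m \<ge> m0 \<longrightarrow> breaker_has_winning_strategy p q m n"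
proof -
  define I where "I = {1..n} \<times> {1..n}"
  \<comment> \<open>The number of zones that \<open>breaker_inv_init\<close> asks for.\<close>
  define N where "N = q * card I * (2 * q) ^ card I + q"
  \<comment> \<open>Zone \<open>z\<close> occupies columns \<open>z * (n + 2) + 1\<close> to
    \<open>(z + 1) * (n + 2)\<close>, so \<open>N * (n + 2)\<close> columns hold all zones.\<close>
  define col where "col z = Suc (z * (n + 2))" for z
  have "breaker_has_winning_strategy p q m n"
    if p: "int p \<le> 2 * int q - 1" and m: "m \<ge> N * (n + 2)" for p m
  proof -
    \<comment> \<open>The bound on \<open>p\<close> is over the integers, so it rules out
      \<open>q = 0\<close>.\<close>
    have q: "q \<ge> 1" and pq: "p < 2 * q" using p by auto
    have col: "1 \<le> col z" "col z + n < m" if "z < N" for z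
    proof -
      have "Suc z * (n + 2) \<le> N * (n + 2)" using that by (intro mult_le_mono1) simp
      then show "col z + n < m" using m by (simp add: col_def)
    qed (simp add: col_def)
    have col_less: "Suc (col z + n) < col z'" if "z < z'" for z z'
      using mult_le_mono1[of "Suc z" z' "n + 2"] that by (simp add: col_def)
    have zone_eq: "z = z'"
      if i: "i \<in> I" "e \<in> zone_pair n (col z) i" and i': "i' \<in> I" "e \<in> zone_pair n (col z') i'"
      for z z' i i' e
    proof -
      note cols = zone_pair_columns[OF i[unfolded I_def]] zone_pair_columns[OF i'[unfolded I_def]]
      obtain v where "v \<in> e" using cols(1) by blast
      then have "col z' \<le> Suc (col z + n)" "col z \<le> Suc (col z' + n)"
        using cols(2)[of v] cols(4)[of v] by auto
      then show ?thesis using col_less[of z z'] col_less[of z' z] by linarith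
    qed
    interpret pair_boxes "{..<N}" I "\<lambda>z. zone_pair n (col z)"
    proof
      fix z i z' i' e
      assume "i \<in> I" "i' \<in> I" "e \<in> zone_pair n (col z) i" "e \<in> zone_pair n (col z') i'"
      moreover from this have "z = z'" using zone_eq by blast
      ultimately show "z = z' \<and> i = i'"
        unfolding I_def using zone_pair_unique by blast
    qed (auto simp: I_def card_zone_pair)
    have zones_sub: "(\<Union>z<N. \<Union>i\<in>I. zone_pair n (col z) i) \<subseteq> grid_edges m n"
      using zone_pair_subset col unfolding I_def by blast
    let ?inv = "\<lambda>h. breaker_inv q (maker_claimed h) (breaker_claimed h)"
    \<comment> \<open>Legality is demanded on every history, but the invariant is carried over only
      where it held. Hence a good reply exists at each Breaker turn, and choosing one gives a
      strategy.\<close>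
    define good where "good h C \<longleftrightarrow> legal_move p q m n h C \<and>
      (?inv h \<longrightarrow> (\<forall>D. legal_move p q m n (h @ [C]) D \<longrightarrow> ?inv (h @ [C, D])))" for h C
    have card_maker: "finite D \<and> card D < 2 * q"
      if "legal_move p q m n h D" "even (length h)" for h D
    proof
      have "D \<subseteq> grid_edges m n" using that by (auto simp: legal_move_def unclaimed_def)
      then show "finite D" using finite_grid_edges by (rule finite_subset)
      show "card D < 2 * q" using that pq by (simp add: legal_move_def)
    qed
    have good_ex: "\<exists>C. good h C" if h: "odd (length h)" for h
    proof (cases "?inv h \<and> \<not> breaker_complete (breaker_claimed h)")
      case True
      from breaker_inv_step[OF conjunct1[OF True] conjunct2[OF True] q] obtain C where
        C: "C \<subseteq> (\<Union>z<N. \<Union>i\<in>I. zone_pair n (col z) i)"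
          "C \<inter> (maker_claimed h \<union> breaker_claimed h) = {}" "card C = q"
          "\<forall>D. finite D \<and> card D < 2 * q \<longrightarrow> breaker_inv q (maker_claimed h \<union> D) (breaker_claimed h \<union> C)"
        by (elim exE conjE)
      have "C \<subseteq> unclaimed m n h" using C(1,2) zones_sub by (auto simp: unclaimed_def Union_history)
      moreover from this have "q \<le> card (unclaimed m n h)"
        using C(3) card_mono[of "unclaimed m n h" C] finite_grid_edges by (auto simp: unclaimed_def)
      ultimately have "legal_move p q m n h C" using h C(3) by (simp add: legal_move_def)
      moreover have "?inv (h @ [C, D])" if "legal_move p q m n (h @ [C]) D" for D
        using C(4)[rule_format, OF card_maker[OF that]] h claimed_snoc[of "h @ [C]" D] claimed_snoc[of h C] by simp
      ultimately show ?thesis by (auto simp: good_def)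
    next
      case False
      \<comment> \<open>Without the invariant there is nothing to preserve, and a complete zone
        stays complete under any move.\<close>
      obtain C where C: "legal_move p q m n h C" using legal_move_ex by blast
      have "?inv (h @ [C, D])" if "?inv h" for D
      proof -
        have "breaker_complete (breaker_claimed h)" using False that by simp
        then have "breaker_complete (breaker_claimed (h @ [C, D]))"
          using breaker_claimed_append by (rule breaker_complete_mono)
        then show ?thesis by (simp add: breaker_inv_def)
      qed
      then show ?thesis using C by (auto simp: good_def)
    qed
    define \<sigma> where "\<sigma> h = (SOME C. good h C)" for h
    have \<sigma>: "good h (\<sigma> h)" if "odd (length h)" for h
      unfolding \<sigma>_def using good_ex[OF that] by (rule someI_ex)
    have "\<exists>t. breaker_has_won p q m n (map f [0..<t])"
      if play: "legal_play p q m n f" and follows: "breaker_follows \<sigma> f" for f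
    proof -
      let ?h = "\<lambda>t. map f [0..<t]"
      have move: "legal_move p q m n (?h t) (f t)" for t
        using play by (simp add: legal_play_def)
      have inv: "?inv (?h (2 * s + 1))" for s
      proof (induction s)
        case 0
        have "breaker_inv q (f 0) {}"
          using card_maker[OF move[of 0]] by (intro breaker_inv_init) (auto simp: N_def)
        then show ?case using claimed_snoc[of "[]" "f 0"] by simp
      next
        case (Suc s)
        have "f (2 * s + 1) = \<sigma> (?h (2 * s + 1))"
          using follows by (simp add: breaker_follows_def)
        then have "good (?h (2 * s + 1)) (f (2 * s + 1))" using \<sigma>[of "?h (2 * s + 1)"] by simp
        moreover have "legal_move p q m n (?h (2 * s + 1) @ [f (2 * s + 1)]) (f (2 * s + 2))"
          using move[of "2 * s + 2"] by simp
        ultimately have "?inv (?h (2 * s + 1) @ [f (2 * s + 1), f (2 * s + 2)])"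
          using Suc unfolding good_def by blast
        then show ?case by simp
      qed
      obtain s where full: "unclaimed m n (?h (2 * s + 1)) = {}"
        using exhausted_ex[OF play q] oddE by metis
      define h where "h = ?h (2 * s + 1)"
      \<comment> \<open>Otherwise \<open>breaker_inv_step\<close> would still find
        \<open>q \<ge> 1\<close> unclaimed edges on the full board.\<close>
      have "breaker_complete (breaker_claimed h)"
      proof (rule ccontr)
        assume incomplete: "\<not> breaker_complete (breaker_claimed h)"
        have "?inv h" unfolding h_def by (rule inv)
        from breaker_inv_step[OF this incomplete q] obtain C where
          C: "C \<subseteq> (\<Union>z<N. \<Union>i\<in>I. zone_pair n (col z) i)"
          "C \<inter> (maker_claimed h \<union> breaker_claimed h) = {}" "card C = q"
          by (elim exE conjE)
        have "C \<subseteq> unclaimed m n h" using C(1,2) zones_sub by (auto simp: unclaimed_def Union_history)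
        then show False using full C(3) q by (simp add: h_def)
      qed
      then obtain z where z: "z < N" "hit (breaker_claimed h) z = I"
        by (auto simp: breaker_complete_def)
      \<comment> \<open>Any later crossing would contain both edges of some pair of zone
        \<open>z\<close>, at least one of which Breaker already holds.\<close>
      have "\<not> maker_has_crossing m n (h @ h')" if legal: "legal_history p q m n (h @ h')" for h'
      proof
        assume "maker_has_crossing m n (h @ h')"
        then obtain P where "left_right_crossing_path m n P" "path_edges P \<subseteq> maker_claimed (h @ h')"
          by (auto simp: maker_has_crossing_def)
        then obtain i where "i \<in> I" "zone_pair n (col z) i \<subseteq> maker_claimed (h @ h')"
          using crossing_contains_zone_pair[of m n P "col z"] col[OF z(1)] unfolding I_def by blast
        moreover from this z(2) have "zone_pair n (col z) i \<inter> breaker_claimed h \<noteq> {}"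
          by (auto simp: hit_def)
        ultimately show False
          using legal_history_disjoint[OF legal] breaker_claimed_append[of h h'] by blast
      qed
      then have "breaker_has_won p q m n h" by (simp add: breaker_has_won_def)
      then show ?thesis unfolding h_def by blast
    qed
    moreover have "breaker_strategy p q m n \<sigma>"
      using \<sigma> by (auto simp: breaker_strategy_def good_def)
    ultimately show ?thesis by (auto simp: breaker_has_winning_strategy_def)
  qed
  then show ?thesis by blast
qed

end
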